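(* Let $m\ge1$. For any choice of real numbers $(k_{ij})_{1\le i<j\le m}$ there exists a unique $m\times m$ correlation matrix $R$ such that $(R^{-1})_{ij}=k_{ij}$ for all $1\le i<j\le m$.
   Context: A correlation matrix here is a real symmetric positive definite matrix all of whose diagonal entries are equal to $1$. *)

theory Defs
  imports "HOL-Analysis.Analysis"
begin

definition positive_definite :: "real ^ 'n ^ 'n \<Rightarrow> bool" where
  "positive_definite A \<longleftrightarrow> transpose A = A \<and> (\<forall>x. x \<noteq> 0 \<longrightarrow> 0 < x \<bullet> (A *v x))"

definition correlation_matrix :: "real ^ 'n ^ 'n \<Rightarrow> bool" where
  "correlation_matrix R \<longleftrightarrow> positive_definite R \<and> (\<forall>i. R $ i $ i = 1)"

end

theory Submission
  imports Defs
begin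

text \<open>
  In terms of \<open>K = R\<inverse>\<close> the claim is that exactly one choice of the diagonal of a symmetric matrix
  with prescribed off-diagonal entries makes it positive definite with \<open>(K\<inverse>)\<^sub>p\<^sub>p = 1\<close> for all \<open>p\<close>.

  Existence is variational. On the set of diagonals \<open>d\<close> for which the completed matrix \<open>K(d)\<close> is
  positive semidefinite, consider \<open>det K(d) * exp (- tr K(d))\<close>. The permutation expansion bounds
  this by \<open>C * exp (- tr K(d) / 2)\<close>, and the diagonals \<open>d\<close> in question are nonnegative, so
  superlevel sets at positive levels are compact and a maximum is attained (\<open>det_exp_functional_max\<close>); its value is
  positive, so \<open>K(d)\<close> is nonsingular there, hence positive definite. Adding \<open>t\<close> to the \<open>p\<close>-th
  diagonal entry multiplies the functional by \<open>(1 + t (K\<inverse>)\<^sub>p\<^sub>p) exp (- t)\<close>, and vanishing of the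
  derivative at \<open>t = 0\<close> is the equation \<open>(K\<inverse>)\<^sub>p\<^sub>p = 1\<close> (\<open>max_inverse_diagonal_one\<close>).

  Uniqueness (\<open>correlation_matrix_unique\<close>): if \<open>R\<^sub>1\<close> and \<open>R\<^sub>2\<close> are two solutions, then
  \<open>D = R\<^sub>1\<inverse> - R\<^sub>2\<inverse>\<close> is diagonal while \<open>R\<^sub>1 - R\<^sub>2 = - R\<^sub>1 D R\<^sub>2\<close> has zero diagonal, so the trace of
  \<open>R\<^sub>1 D R\<^sub>2 D\<close> vanishes. For positive definite \<open>R\<^sub>1\<close>, \<open>R\<^sub>2\<close> this forces \<open>D = 0\<close>
  (\<open>diagonal_congruence_trace_zero\<close>).
\<close>

section \<open>Positive semidefinite matrices\<close>

text \<open>As for positive definiteness, symmetry is part of the notion.\<close>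
definition positive_semidefinite :: "real ^ 'n ^ 'n \<Rightarrow> bool" where
  "positive_semidefinite A \<longleftrightarrow> transpose A = A \<and> (\<forall>x. 0 \<le> x \<bullet> (A *v x))"

lemma positive_definite_imp_semidefinite:
  "positive_definite A \<Longrightarrow> positive_semidefinite A"
  unfolding positive_definite_def positive_semidefinite_def
  by (metis inner_zero_left less_eq_real_def)

lemma symmetric_inner_commute:
  fixes A :: "real ^ 'n ^ 'n"
  assumes "transpose A = A"
  shows "x \<bullet> (A *v y) = y \<bullet> (A *v x)"
  by (metis assms dot_lmul_matrix inner_commute vector_transpose_matrix)

lemma symmetric_entry_commute: "transpose A = A \<Longrightarrow> A $ i $ j = A $ j $ i"
  by (metis transpose_def vec_lambda_beta)

lemma entry_eq_inner_axis:
  fixes A :: "real ^ 'n ^ 'n"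
  shows "A $ i $ j = axis i 1 \<bullet> (A *v axis j 1)"
  by (simp add: inner_axis' matrix_vector_mul_component inner_axis)

lemma inner_matrix_vector_eq_sum:
  fixes A :: "real ^ 'n ^ 'n"
  shows "x \<bullet> (A *v y) = (\<Sum>i\<in>UNIV. \<Sum>j\<in>UNIV. A $ i $ j * x $ i * y $ j)"
  by (simp add: inner_vec_def matrix_vector_mult_def sum_distrib_left mult_ac)

lemma semidefinite_Cauchy_Schwarz:
  fixes A :: "real ^ 'n ^ 'n"
  assumes "positive_semidefinite A"
  shows "(x \<bullet> (A *v y))\<^sup>2 \<le> (x \<bullet> (A *v x)) * (y \<bullet> (A *v y))"
proof -
  define a b c where "a = x \<bullet> (A *v x)" and "b = x \<bullet> (A *v y)" and "c = y \<bullet> (A *v y)"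
  have sym: "y \<bullet> (A *v x) = b"
    using assms symmetric_inner_commute unfolding b_def positive_semidefinite_def by blast
  have q: "0 \<le> s\<^sup>2 * a + 2 * s * t * b + t\<^sup>2 * c" for s t
  proof -
    have "0 \<le> (s *\<^sub>R x + t *\<^sub>R y) \<bullet> (A *v (s *\<^sub>R x + t *\<^sub>R y))"
      using assms unfolding positive_semidefinite_def by blast
    also have "\<dots> = s\<^sup>2 * a + 2 * s * t * b + t\<^sup>2 * c"
      by (simp add: matrix_vector_right_distrib matrix_vector_mult_scaleR inner_add_left
          inner_add_right sym a_def[symmetric] b_def[symmetric] c_def[symmetric]
          algebra_simps power2_eq_square)
    finally show ?thesis .
  qed
  have "b\<^sup>2 \<le> a * c"
  proof (cases "c = 0")
    case True
    have "b = 0"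
    proof (rule ccontr)
      assume "b \<noteq> 0"
      \<comment> \<open>The form would then be affine and nonconstant in \<open>t\<close>; at this \<open>t\<close> its value is \<open>-1\<close>.\<close>
      then show False
        using q[of 1 "- (a + 1) / (2 * b)"] True by (simp add: field_simps)
    qed
    then show ?thesis using True by simp
  next
    case False
    have "0 \<le> c" using q[of 0 1] by simp
    with False have "0 < c" by simp
    have "0 \<le> c * (a * c - b\<^sup>2)"
      using q[of c "- b"] by (simp add: algebra_simps power2_eq_square)
    with \<open>0 < c\<close> show ?thesis by (simp add: zero_le_mult_iff)
  qed
  then show ?thesis by (simp add: a_def b_def c_def)
qed

lemma semidefinite_form_zero:
  fixes A :: "real ^ 'n ^ 'n"
  assumes "positive_semidefinite A" "x \<bullet> (A *v x) = 0"
  shows "A *v x = 0"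
  using semidefinite_Cauchy_Schwarz[OF assms(1), of "A *v x" x] assms(2) by simp

lemma matrix_diff_ldistrib:
  fixes A :: "real ^ 'n ^ 'm"
  shows "A ** (B - C) = A ** B - A ** C"
  by (simp add: vec_eq_iff matrix_matrix_mult_def right_diff_distrib sum_subtractf)

lemma matrix_diff_rdistrib:
  fixes A B :: "real ^ 'n ^ 'm"
  shows "(A - B) ** C = A ** C - B ** C"
  by (simp add: vec_eq_iff matrix_matrix_mult_def left_diff_distrib sum_subtractf)

lemma matrix_inv_cancel:
  fixes A :: "real ^ 'n ^ 'n"
  assumes "invertible A"
  shows "A ** matrix_inv A = mat 1" "matrix_inv A ** A = mat 1"
proof -
  have "A ** matrix_inv A = mat 1 \<and> matrix_inv A ** A = mat 1"
    unfolding matrix_inv_def by (rule someI_ex) (use assms in \<open>simp add: invertible_def\<close>)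
  then show "A ** matrix_inv A = mat 1" "matrix_inv A ** A = mat 1" by auto
qed

lemma matrix_inv_matrix_inv:
  fixes A :: "real ^ 'n ^ 'n"
  assumes "invertible A"
  shows "matrix_inv (matrix_inv A) = A"
proof -
  have "invertible (matrix_inv A)"
    using matrix_inv_cancel[OF assms] unfolding invertible_def by blast
  then have "matrix_inv A ** matrix_inv (matrix_inv A) = mat 1"
    by (rule matrix_inv_cancel)
  then have "(A ** matrix_inv A) ** matrix_inv (matrix_inv A) = A"
    by (simp add: matrix_mul_assoc[symmetric])
  then show ?thesis by (simp add: matrix_inv_cancel[OF assms])
qed

lemma positive_definite_iff_semidefinite_det:
  fixes A :: "real ^ 'n ^ 'n"
  shows "positive_definite A \<longleftrightarrow> positive_semidefinite A \<and> det A \<noteq> 0"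
proof
  assume pd: "positive_definite A"
  then have "\<forall>x. A *v x = 0 \<longrightarrow> x = 0"
    unfolding positive_definite_def by (metis inner_zero_right less_irrefl)
  then have "invertible A"
    using matrix_left_invertible_ker invertible_left_inverse by blast
  then show "positive_semidefinite A \<and> det A \<noteq> 0"
    using pd positive_definite_imp_semidefinite invertible_det_nz by blast
next
  assume A: "positive_semidefinite A \<and> det A \<noteq> 0"
  then have "\<forall>x. A *v x = 0 \<longrightarrow> x = 0"
    using matrix_left_invertible_ker invertible_left_inverse invertible_det_nz by blast
  then have "x \<noteq> 0 \<Longrightarrow> x \<bullet> (A *v x) \<noteq> 0" for x
    using semidefinite_form_zero A by blast
  then show "positive_definite A"
    using A unfolding positive_definite_def positive_semidefinite_def
    by (metis less_eq_real_def)
qed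

lemma positive_definite_invertible: "positive_definite A \<Longrightarrow> invertible A"
  by (simp add: positive_definite_iff_semidefinite_det invertible_det_nz)

lemma positive_definite_matrix_inv:
  fixes A :: "real ^ 'n ^ 'n"
  assumes "positive_definite A"
  shows "positive_definite (matrix_inv A)"
proof -
  note inv = positive_definite_invertible[OF assms]
  have sym: "transpose A = A" using assms unfolding positive_definite_def by blast
  have "transpose (matrix_inv A) ** A = mat 1"
    by (metis matrix_inv_cancel(1)[OF inv] matrix_transpose_mul sym transpose_mat)
  then have "transpose (matrix_inv A) = matrix_inv A"
    by (metis matrix_inv_cancel(1)[OF inv] matrix_mul_assoc matrix_mul_lid matrix_mul_rid)
  moreover have "0 < x \<bullet> (matrix_inv A *v x)" if "x \<noteq> 0" for x
  proof -
    define y where "y = matrix_inv A *v x"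
    have x: "x = A *v y"
      by (simp add: y_def matrix_vector_mul_assoc matrix_inv_cancel[OF inv])
    with that have "y \<noteq> 0" by auto
    then have "0 < y \<bullet> (A *v y)" using assms unfolding positive_definite_def by blast
    then show ?thesis by (simp add: x[symmetric] y_def[symmetric] inner_commute)
  qed
  ultimately show ?thesis unfolding positive_definite_def by blast
qed

lemma positive_definite_diagonal_pos:
  fixes A :: "real ^ 'n ^ 'n"
  assumes "positive_definite A"
  shows "0 < A $ i $ i"
  using assms unfolding entry_eq_inner_axis positive_definite_def by (simp add: axis_eq_0_iff)

text \<open>Cauchy--Schwarz for the pair \<open>x\<close>, \<open>A\<inverse> e\<^sub>i\<close>. Equivalently, \<open>A - e\<^sub>i e\<^sub>i\<^sup>T / (A\<inverse>)\<^sub>i\<^sub>i\<close> is positive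
  semidefinite.\<close>
lemma component_square_le_form:
  fixes A :: "real ^ 'n ^ 'n"
  assumes "positive_definite A"
  shows "(x $ i)\<^sup>2 \<le> matrix_inv A $ i $ i * (x \<bullet> (A *v x))"
proof -
  define y where "y = matrix_inv A *v axis i 1"
  have Ay: "A *v y = axis i 1"
    by (simp add: y_def matrix_vector_mul_assoc
        matrix_inv_cancel[OF positive_definite_invertible[OF assms]])
  have "y \<bullet> (A *v y) = matrix_inv A $ i $ i"
    unfolding Ay unfolding y_def entry_eq_inner_axis by (rule inner_commute)
  moreover have "x \<bullet> (A *v y) = x $ i" by (simp add: Ay inner_axis)
  ultimately show ?thesis
    using semidefinite_Cauchy_Schwarz[OF positive_definite_imp_semidefinite[OF assms], of x y]
    by (simp add: mult.commute)
qed

section \<open>The trace pairing\<close>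

text \<open>The trace of the product of two positive semidefinite matrices is nonnegative. Subtracting
  from \<open>A\<close> the rank-one matrix \<open>A e\<^sub>p (A e\<^sub>p)\<^sup>T / A\<^sub>p\<^sub>p\<close> keeps it positive semidefinite, by
  Cauchy--Schwarz, clears its \<open>p\<close>-th diagonal entry and creates no new nonzero one; the proof is
  by induction on the number of nonzero diagonal entries.\<close>
lemma semidefinite_trace_nonneg:
  fixes A B :: "real ^ 'n ^ 'n"
  assumes "positive_semidefinite A" "positive_semidefinite B"
  shows "0 \<le> (\<Sum>i\<in>UNIV. \<Sum>j\<in>UNIV. A $ i $ j * B $ i $ j)"
  using assms(1)
proof (induction "card {i. A $ i $ i \<noteq> 0}" arbitrary: A rule: less_induct)
  case less
  note A = less.prems
  have sym: "A $ i $ j = A $ j $ i" for i j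
    using A symmetric_entry_commute unfolding positive_semidefinite_def by blast
  have entry: "(A $ i $ j)\<^sup>2 \<le> A $ i $ i * A $ j $ j" for i j
    unfolding entry_eq_inner_axis by (rule semidefinite_Cauchy_Schwarz[OF A])
  show ?case
  proof (cases "\<exists>p. A $ p $ p \<noteq> 0")
    case False
    then have "A $ i $ j = 0" for i j using entry[of i j] by simp
    then show ?thesis by simp
  next
    case True
    then obtain p where p: "A $ p $ p \<noteq> 0" by blast
    have "0 \<le> A $ p $ p"
      using A unfolding positive_semidefinite_def entry_eq_inner_axis by blast
    with p have app: "0 < A $ p $ p" by simp
    define v where "v = A *v axis p 1"
    have v: "v $ i = A $ i $ p" for i
      by (simp add: v_def matrix_vector_mul_component inner_axis)
    define A' where "A' = (\<chi> i j. A $ i $ j - v $ i * v $ j / A $ p $ p)"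
    have form: "x \<bullet> (A' *v x) = x \<bullet> (A *v x) - (x \<bullet> v)\<^sup>2 / A $ p $ p" for x
    proof -
      have "(x \<bullet> v)\<^sup>2 = (\<Sum>i\<in>UNIV. \<Sum>j\<in>UNIV. (v $ i * v $ j) * x $ i * x $ j)"
        by (simp add: inner_vec_def power2_eq_square sum_product mult_ac)
      then show ?thesis
        by (simp add: inner_matrix_vector_eq_sum A'_def sum_subtractf left_diff_distrib
            sum_divide_distrib)
    qed
    have "(x \<bullet> v)\<^sup>2 \<le> (x \<bullet> (A *v x)) * A $ p $ p" for x
      unfolding v_def entry_eq_inner_axis[of A p p] by (rule semidefinite_Cauchy_Schwarz[OF A])
    then have "0 \<le> x \<bullet> (A' *v x)" for x
      unfolding form using app by (simp add: field_simps)
    moreover have "transpose A' = A'"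
      by (simp add: transpose_def A'_def vec_eq_iff sym mult.commute)
    ultimately have A': "positive_semidefinite A'"
      unfolding positive_semidefinite_def by blast
    have "A' $ i $ i = 0" if "A $ i $ i = 0" for i
      using that entry[of i p] by (simp add: A'_def v)
    moreover have "A' $ p $ p = 0" using p by (simp add: A'_def v)
    ultimately have "{i. A' $ i $ i \<noteq> 0} \<subset> {i. A $ i $ i \<noteq> 0}" using p by blast
    then have "card {i. A' $ i $ i \<noteq> 0} < card {i. A $ i $ i \<noteq> 0}"
      by (simp add: psubset_card_mono)
    from less.hyps[OF this A']
    have IH: "0 \<le> (\<Sum>i\<in>UNIV. \<Sum>j\<in>UNIV. A' $ i $ j * B $ i $ j)" .
    have "(\<Sum>i\<in>UNIV. \<Sum>j\<in>UNIV. A $ i $ j * B $ i $ j)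
        = (\<Sum>i\<in>UNIV. \<Sum>j\<in>UNIV. A' $ i $ j * B $ i $ j) + v \<bullet> (B *v v) / A $ p $ p"
      unfolding inner_matrix_vector_eq_sum sum_divide_distrib sum.distrib[symmetric]
      by (intro sum.cong refl) (simp add: A'_def algebra_simps)
    moreover have "0 \<le> v \<bullet> (B *v v)"
      using assms(2) unfolding positive_semidefinite_def by blast
    ultimately show ?thesis using IH app by simp
  qed
qed

text \<open>For \<open>D = diag d\<close> the sum is the trace of \<open>A D B D\<close>, which is at least
  \<open>d\<^sub>p\<^sup>2 B\<^sub>p\<^sub>p / (A\<inverse>)\<^sub>p\<^sub>p\<close> for every index \<open>p\<close>.\<close>
lemma diagonal_congruence_trace_zero:
  fixes A B :: "real ^ 'n ^ 'n"
  assumes A: "positive_definite A" and B: "positive_definite B"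
    and zero: "(\<Sum>i\<in>UNIV. \<Sum>j\<in>UNIV. A $ i $ j * B $ i $ j * d i * d j) = 0"
  shows "d p = 0"
proof -
  have symA: "A $ i $ j = A $ j $ i" and symB: "B $ i $ j = B $ j $ i" for i j
    using A B symmetric_entry_commute unfolding positive_definite_def by blast+
  define c where "c = matrix_inv A $ p $ p"
  have c: "0 < c"
    unfolding c_def by (intro positive_definite_diagonal_pos positive_definite_matrix_inv A)
  define A' where "A' = (\<chi> i j. A $ i $ j - (if i = p \<and> j = p then 1 / c else 0))"
  define Q where "Q = (\<chi> i j. B $ i $ j * d i * d j)"
  have delta: "(\<Sum>i\<in>UNIV. \<Sum>j\<in>UNIV. (if i = p \<and> j = p then f i j else 0)) = (f p p :: real)" for f
  proof -
    have "(\<Sum>j\<in>UNIV. (if i = p \<and> j = p then f i j else 0)) = (if i = p then f i p else 0)" for i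
      by (cases "i = p") simp_all
    then show ?thesis by simp
  qed
  have "x \<bullet> (A' *v x) = x \<bullet> (A *v x) - (x $ p)\<^sup>2 / c" for x
  proof -
    have "x \<bullet> (A' *v x) = (\<Sum>i\<in>UNIV. \<Sum>j\<in>UNIV. A $ i $ j * x $ i * x $ j
        - (if i = p \<and> j = p then x $ i * x $ j / c else 0))"
      unfolding inner_matrix_vector_eq_sum
      by (intro sum.cong refl) (simp add: A'_def algebra_simps)
    also have "\<dots> = x \<bullet> (A *v x) - (x $ p)\<^sup>2 / c"
      unfolding inner_matrix_vector_eq_sum sum_subtractf delta by (simp add: power2_eq_square)
    finally show ?thesis .
  qed
  moreover have "(x $ p)\<^sup>2 / c \<le> x \<bullet> (A *v x)" for x
    using component_square_le_form[OF A, of x p] c by (simp add: c_def field_simps)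
  moreover have "transpose A' = A'"
    by (auto simp: transpose_def A'_def vec_eq_iff symA)
  ultimately have A': "positive_semidefinite A'"
    unfolding positive_semidefinite_def by simp
  have "x \<bullet> (Q *v x) = (\<chi> i. d i * x $ i) \<bullet> (B *v (\<chi> i. d i * x $ i))" for x
    unfolding inner_matrix_vector_eq_sum Q_def
    by (intro sum.cong refl) (simp add: mult_ac)
  moreover have "transpose Q = Q"
    by (simp add: transpose_def Q_def vec_eq_iff symB mult_ac)
  ultimately have Q: "positive_semidefinite Q"
    using positive_definite_imp_semidefinite[OF B] unfolding positive_semidefinite_def by simp
  have "0 \<le> (\<Sum>i\<in>UNIV. \<Sum>j\<in>UNIV. A' $ i $ j * Q $ i $ j)"
    by (rule semidefinite_trace_nonneg[OF A' Q])
  also have "\<dots> = (\<Sum>i\<in>UNIV. \<Sum>j\<in>UNIV. A $ i $ j * B $ i $ j * d i * d j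
      - (if i = p \<and> j = p then B $ i $ j * d i * d j / c else 0))"
    by (intro sum.cong refl) (simp add: A'_def Q_def algebra_simps)
  also have "\<dots> = - (B $ p $ p * (d p)\<^sup>2 / c)"
    unfolding sum_subtractf delta zero by (simp add: power2_eq_square)
  finally have "B $ p $ p * (d p)\<^sup>2 \<le> 0"
    using c by (simp add: divide_le_0_iff)
  with positive_definite_diagonal_pos[OF B, of p] show ?thesis
    by (simp add: mult_le_0_iff)
qed

text \<open>With \<open>d\<close> the diagonal of \<open>R\<^sub>1\<inverse> - R\<^sub>2\<inverse>\<close>, the identity \<open>R\<^sub>1 - R\<^sub>2 = - R\<^sub>1 (diag d) R\<^sub>2\<close> has zero
  diagonal; pairing that diagonal with \<open>d\<close> gives the trace of \<open>R\<^sub>1 (diag d) R\<^sub>2 (diag d)\<close>.\<close>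
lemma correlation_matrix_unique:
  fixes R1 R2 :: "real ^ 'n::{finite,linorder} ^ 'n::{finite,linorder}"
  assumes R1: "correlation_matrix R1" and R2: "correlation_matrix R2"
    and eq: "\<And>i j. i < j \<Longrightarrow> matrix_inv R1 $ i $ j = matrix_inv R2 $ i $ j"
  shows "R1 = R2"
proof -
  define K1 K2 where "K1 = matrix_inv R1" and "K2 = matrix_inv R2"
  have pd: "positive_definite R1" "positive_definite R2"
    and diag: "R1 $ i $ i = 1" "R2 $ i $ i = 1" for i
    using R1 R2 unfolding correlation_matrix_def by auto
  have K: "positive_definite K1" "positive_definite K2"
    unfolding K1_def K2_def by (intro positive_definite_matrix_inv pd)+
  have symK: "K1 $ i $ j = K1 $ j $ i" "K2 $ i $ j = K2 $ j $ i" for i j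
    using K symmetric_entry_commute unfolding positive_definite_def by blast+
  have symR: "R2 $ i $ j = R2 $ j $ i" for i j
    using pd symmetric_entry_commute unfolding positive_definite_def by blast
  have off: "K1 $ i $ j = K2 $ i $ j" if "i \<noteq> j" for i j
    using that eq[of i j] eq[of j i] symK[of i j] unfolding K1_def K2_def
    by (metis linorder_neq_iff)
  define d where "d i = K1 $ i $ i - K2 $ i $ i" for i
  have inv: "R1 ** K1 = mat 1" "K2 ** R2 = mat 1" "matrix_inv K1 = R1" "matrix_inv K2 = R2"
    unfolding K1_def K2_def
    using pd by (simp_all add: matrix_inv_cancel matrix_inv_matrix_inv positive_definite_invertible)
  have D: "(K1 - K2) $ i $ j = (if i = j then d j else 0)" for i j
    using off[of i j] by (simp add: d_def)
  have "R1 ** ((K1 - K2) ** R2) = (R1 ** K1) ** R2 - R1 ** (K2 ** R2)"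
    by (simp add: matrix_diff_ldistrib matrix_diff_rdistrib matrix_mul_assoc)
  also have "\<dots> = R2 - R1" by (simp add: inv)
  finally have R: "R1 ** ((K1 - K2) ** R2) = R2 - R1" .
  have DR: "((K1 - K2) ** R2) $ j $ i = d j * R2 $ j $ i" for i j
  proof -
    have "((K1 - K2) ** R2) $ j $ i = (\<Sum>l\<in>UNIV. (K1 - K2) $ j $ l * R2 $ l $ i)"
      by (simp add: matrix_matrix_mult_def)
    also have "\<dots> = (\<Sum>l\<in>UNIV. if j = l then d l * R2 $ l $ i else 0)"
      unfolding D by (intro sum.cong refl) simp
    finally show ?thesis by simp
  qed
  have "(\<Sum>j\<in>UNIV. R1 $ i $ j * R2 $ i $ j * d j) = 0" for i
  proof -
    have "(\<Sum>j\<in>UNIV. R1 $ i $ j * R2 $ i $ j * d j) = (R1 ** ((K1 - K2) ** R2)) $ i $ i"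
      using symR[of i] DR by (simp add: matrix_matrix_mult_def mult_ac)
    then show ?thesis unfolding R by (simp add: diag)
  qed
  then have "(\<Sum>i\<in>UNIV. d i * (\<Sum>j\<in>UNIV. R1 $ i $ j * R2 $ i $ j * d j)) = 0"
    by simp
  then have "(\<Sum>i\<in>UNIV. \<Sum>j\<in>UNIV. R1 $ i $ j * R2 $ i $ j * d i * d j) = 0"
    by (simp add: sum_distrib_left mult_ac)
  then have "d i = 0" for i by (rule diagonal_congruence_trace_zero[OF pd])
  then have "K1 $ i $ j = K2 $ i $ j" for i j
    by (cases "i = j") (simp_all add: off d_def)
  then have "K1 = K2" by (simp add: vec_eq_iff)
  then show ?thesis using inv by simp
qed

section \<open>Determinants\<close>

lemma det_le_fact_prod:
  fixes A :: "real ^ 'n ^ 'n"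
  assumes "\<And>i j. \<bar>A $ i $ j\<bar> \<le> b i"
  shows "det A \<le> fact CARD('n) * (\<Prod>i\<in>UNIV. b i)"
proof -
  have "of_int (sign p) * (\<Prod>i\<in>UNIV. A $ i $ p i) \<le> (\<Prod>i\<in>UNIV. b i)" for p :: "'n \<Rightarrow> 'n"
  proof -
    have "of_int (sign p) * (\<Prod>i\<in>UNIV. A $ i $ p i) \<le> \<bar>of_int (sign p) * (\<Prod>i\<in>UNIV. A $ i $ p i)\<bar>"
      by simp
    also have "\<dots> = (\<Prod>i\<in>UNIV. \<bar>A $ i $ p i\<bar>)"
      by (simp add: abs_mult abs_prod sign_def)
    also have "\<dots> \<le> (\<Prod>i\<in>UNIV. b i)" by (intro prod_mono) (simp add: assms)
    finally show ?thesis .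
  qed
  then have "det A \<le> (\<Sum>p | p permutes (UNIV :: 'n set). \<Prod>i\<in>UNIV. b i)"
    unfolding det_def by (intro sum_mono)
  also have "\<dots> = fact CARD('n) * (\<Prod>i\<in>UNIV. b i)"
    by (simp add: card_permutations)
  finally show ?thesis .
qed

text \<open>The segment from the identity to \<open>A\<close> consists of positive definite, hence nonsingular, matrices,
  so the determinant keeps the sign that it has at the identity.\<close>
lemma positive_definite_det_pos:
  fixes A :: "real ^ 'n ^ 'n"
  assumes "positive_definite A"
  shows "0 < det A"
proof (rule ccontr)
  assume neg: "\<not> 0 < det A"
  define h where "h u = det ((\<chi> i j. (1 - u) * mat 1 $ i $ j + u * A $ i $ j) :: real ^ 'n ^ 'n)"
    for u :: real
  have cont: "continuous_on {0..1} h"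
    unfolding h_def det_def by (simp, intro continuous_intros)
  have "h 0 = det (mat 1 :: real ^ 'n ^ 'n)" unfolding h_def
    by (rule arg_cong[where f = det]) (simp add: vec_eq_iff)
  then have h0: "h 0 = 1" by simp
  have "h 1 = det A" unfolding h_def
    by (rule arg_cong[where f = det]) (simp add: vec_eq_iff)
  then obtain u where u: "0 \<le> u" "u \<le> 1" "h u = 0"
    using IVT2'[of h 1 0 0] cont h0 neg by auto
  define M :: "real ^ 'n ^ 'n" where "M = (\<chi> i j. (1 - u) * mat 1 $ i $ j + u * A $ i $ j)"
  have form: "x \<bullet> (M *v x) = (1 - u) * (x \<bullet> x) + u * (x \<bullet> (A *v x))" for x
  proof -
    have "x \<bullet> (M *v x) = (1 - u) * (x \<bullet> (mat 1 *v x)) + u * (x \<bullet> (A *v x))"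
      unfolding inner_matrix_vector_eq_sum M_def
      by (simp add: sum_distrib_left sum.distrib[symmetric] algebra_simps)
    then show ?thesis by simp
  qed
  have "0 < x \<bullet> (M *v x)" if "x \<noteq> 0" for x
  proof (cases "u = 0")
    case True
    then show ?thesis using that by (simp add: form)
  next
    case False
    then have "0 < u * (x \<bullet> (A *v x))"
      using that u assms unfolding positive_definite_def by simp
    moreover have "0 \<le> (1 - u) * (x \<bullet> x)" using u by simp
    ultimately show ?thesis unfolding form by linarith
  qed
  moreover have "transpose M = M"
  proof -
    have "A $ i $ j = A $ j $ i" for i j
      using assms symmetric_entry_commute unfolding positive_definite_def by blast
    then show ?thesis by (simp add: transpose_def M_def vec_eq_iff mat_def)
  qed
  ultimately have "positive_definite M" unfolding positive_definite_def by blast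
  then have "det M \<noteq> 0" by (simp add: positive_definite_iff_semidefinite_det)
  with u show False by (simp add: h_def M_def)
qed

text \<open>Along a diagonal entry the determinant is affine: \<open>K + t e\<^sub>p e\<^sub>p\<^sup>T\<close> arises from \<open>K\<close> by replacing
  its \<open>p\<close>-th column with \<open>K (e\<^sub>p + t K\<inverse> e\<^sub>p)\<close>, so Cramer's rule applies.\<close>
lemma det_add_diagonal_entry:
  fixes K :: "real ^ 'n ^ 'n"
  assumes "invertible K"
  shows "det (\<chi> i j. K $ i $ j + (if i = p \<and> j = p then t else 0))
    = (1 + t * matrix_inv K $ p $ p) * det K"
proof -
  define x where "x = axis p 1 + t *\<^sub>R (matrix_inv K *v axis p 1)"
  have "K *v x = K *v axis p 1 + t *\<^sub>R axis p 1"
    by (simp add: x_def matrix_vector_right_distrib matrix_vector_mult_scaleR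
        matrix_vector_mul_assoc matrix_inv_cancel[OF assms])
  then have Kx: "(K *v x) $ i = K $ i $ p + (if i = p then t else 0)" for i
    by (simp add: matrix_vector_mul_component inner_axis) (simp add: axis_def)
  have "(\<chi> i j. K $ i $ j + (if i = p \<and> j = p then t else 0))
      = (\<chi> i j. if j = p then (K *v x) $ i else K $ i $ j)"
    by (simp add: vec_eq_iff Kx)
  then have "det (\<chi> i j. K $ i $ j + (if i = p \<and> j = p then t else 0)) = x $ p * det K"
    by (simp add: cramer_lemma)
  also have "x $ p = 1 + t * matrix_inv K $ p $ p"
    by (simp add: x_def matrix_vector_mul_component inner_axis)
  finally show ?thesis .
qed

section \<open>Completing the diagonal\<close>

text \<open>The symmetric matrix with diagonal \<open>d\<close> and entry \<open>k i j\<close> at each position \<open>i < j\<close>; the values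
  of \<open>k\<close> on and below the diagonal play no role.\<close>
definition symmetric_completion ::
    "('n::{finite,linorder} \<Rightarrow> 'n \<Rightarrow> real) \<Rightarrow> real ^ 'n::{finite,linorder}
      \<Rightarrow> real ^ 'n::{finite,linorder} ^ 'n::{finite,linorder}" where
  "symmetric_completion k d = (\<chi> i j. if i = j then d $ i else if i < j then k i j else k j i)"

lemma transpose_symmetric_completion:
  "transpose (symmetric_completion k d) = symmetric_completion k d"
  by (auto simp: transpose_def symmetric_completion_def vec_eq_iff)

lemma symmetric_completion_form:
  "x \<bullet> (symmetric_completion k d *v x)
    = x \<bullet> (symmetric_completion k 0 *v x) + (\<Sum>i\<in>UNIV. d $ i * (x $ i)\<^sup>2)"
proof -
  have "x \<bullet> (symmetric_completion k d *v x) = (\<Sum>i\<in>UNIV. \<Sum>j\<in>UNIV.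
      symmetric_completion k 0 $ i $ j * x $ i * x $ j + (if i = j then d $ i * (x $ i)\<^sup>2 else 0))"
    unfolding inner_matrix_vector_eq_sum
    by (intro sum.cong refl) (simp add: symmetric_completion_def power2_eq_square)
  then show ?thesis by (simp add: inner_matrix_vector_eq_sum sum.distrib)
qed

lemma symmetric_completion_add_axis:
  "symmetric_completion k (d + t *\<^sub>R axis p 1)
    = (\<chi> i j. symmetric_completion k d $ i $ j + (if i = p \<and> j = p then t else 0))"
  by (auto simp: symmetric_completion_def vec_eq_iff axis_def)

lemma continuous_on_det_symmetric_completion:
  "continuous_on S (\<lambda>d. det (symmetric_completion k d))"
proof -
  have "continuous_on S (\<lambda>d. symmetric_completion k d $ i $ j)" for i j
    by (cases "i = j") (auto simp: symmetric_completion_def intro!: continuous_on_component)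
  then show ?thesis
    unfolding det_def by (intro continuous_on_sum continuous_on_mult continuous_on_prod
        continuous_on_const) blast
qed

lemma symmetric_completion_semidefinite_iff:
  "positive_semidefinite (symmetric_completion k d)
    \<longleftrightarrow> (\<forall>x. 0 \<le> x \<bullet> (symmetric_completion k d *v x))"
  by (simp add: positive_semidefinite_def transpose_symmetric_completion)

lemma closed_semidefinite_diagonals:
  "closed {d. positive_semidefinite (symmetric_completion k d)}"
proof -
  have "positive_semidefinite (symmetric_completion k d) \<longleftrightarrow>
      (\<forall>x. 0 \<le> x \<bullet> (symmetric_completion k 0 *v x) + (\<Sum>i\<in>UNIV. d $ i * (x $ i)\<^sup>2))" for d
    by (simp add: symmetric_completion_semidefinite_iff symmetric_completion_form[of _ k d])
  then have "{d. positive_semidefinite (symmetric_completion k d)}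
      = (\<Inter>x. {d. 0 \<le> x \<bullet> (symmetric_completion k 0 *v x) + (\<Sum>i\<in>UNIV. d $ i * (x $ i)\<^sup>2)})"
    by auto
  also have "closed \<dots>"
    by (intro closed_INT ballI closed_Collect_le continuous_intros)
  finally show ?thesis .
qed

lemma semidefinite_diagonal_nonneg:
  assumes "positive_semidefinite (symmetric_completion k d)"
  shows "0 \<le> d $ i"
proof -
  have "symmetric_completion k d $ i $ i = d $ i" by (simp add: symmetric_completion_def)
  then show ?thesis
    using assms unfolding positive_semidefinite_def entry_eq_inner_axis by metis
qed

text \<open>A constant diagonal that exceeds the operator norm of the off-diagonal part suffices.\<close>
lemma exists_positive_definite_completion:
  "\<exists>d. positive_definite (symmetric_completion k d)"
proof -
  let ?N = "symmetric_completion k 0"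
  obtain B where B: "\<And>x. norm (?N *v x) \<le> B * norm x"
    using linear_bounded[of "\<lambda>x. ?N *v x"] matrix_vector_mul_linear by blast
  define d :: "real ^ 'a::{finite,linorder}" where "d = (\<chi> i. B + 1)"
  have "0 < x \<bullet> (symmetric_completion k d *v x)" if "x \<noteq> 0" for x
  proof -
    have "\<bar>x \<bullet> (?N *v x)\<bar> \<le> norm x * norm (?N *v x)" by (rule Cauchy_Schwarz_ineq2)
    also have "\<dots> \<le> norm x * (B * norm x)" by (intro mult_left_mono B) simp
    also have "\<dots> = B * (x \<bullet> x)" by (simp add: dot_square_norm power2_eq_square)
    finally have "- (B * (x \<bullet> x)) \<le> x \<bullet> (?N *v x)" by linarith
    moreover have "(\<Sum>i\<in>UNIV. d $ i * (x $ i)\<^sup>2) = (B + 1) * (x \<bullet> x)"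
      by (simp add: d_def inner_vec_def sum_distrib_left power2_eq_square)
    moreover have "0 < x \<bullet> x" using that by simp
    ultimately show ?thesis
      unfolding symmetric_completion_form[of x k d] distrib_right by linarith
  qed
  then show ?thesis
    unfolding positive_definite_def using transpose_symmetric_completion by blast
qed

section \<open>The variational problem\<close>

text \<open>The functional whose logarithm is \<open>log det K - tr K\<close> where \<open>det K\<close> is positive; it is used in
  exponential form because it is then also continuous at singular completions.
  Its critical points on the positive definite completions \<open>K\<close> are those with \<open>(K\<inverse>)\<^sub>p\<^sub>p = 1\<close> for all \<open>p\<close>.\<close>
definition det_exp_functional :: "('n \<Rightarrow> 'n \<Rightarrow> real) \<Rightarrow> real ^ 'n::{finite,linorder} \<Rightarrow> real" where
  "det_exp_functional k d = det (symmetric_completion k d) * exp (- (\<Sum>i\<in>UNIV. d $ i))"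

lemma det_exp_functional_bound:
  fixes k :: "'n::{finite,linorder} \<Rightarrow> 'n \<Rightarrow> real"
  obtains C where "0 < C"
    "\<And>d. (\<And>i. 0 \<le> d $ i) \<Longrightarrow> det_exp_functional k d \<le> C * exp (- (\<Sum>i\<in>UNIV. d $ i) / 2)"
proof -
  define c where "c = 1 + (\<Sum>i\<in>UNIV. \<Sum>j\<in>UNIV. \<bar>k i j\<bar>)"
  have c1: "1 \<le> c" unfolding c_def by (simp add: sum_nonneg)
  have kc: "\<bar>k i j\<bar> \<le> c" for i j
  proof -
    have "\<bar>k i j\<bar> \<le> (\<Sum>j\<in>UNIV. \<bar>k i j\<bar>)" by (rule member_le_sum) auto
    also have "\<dots> \<le> (\<Sum>i\<in>UNIV. \<Sum>j\<in>UNIV. \<bar>k i j\<bar>)"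
      by (rule member_le_sum[where f = "\<lambda>i. \<Sum>j\<in>UNIV. \<bar>k i j\<bar>"]) (auto intro: sum_nonneg)
    finally show ?thesis by (simp add: c_def)
  qed
  have bound: "det_exp_functional k d
      \<le> fact CARD('n) * (2 * c) ^ CARD('n) * exp (- (\<Sum>i\<in>UNIV. d $ i) / 2)"
    if d: "\<And>i. 0 \<le> d $ i" for d :: "real ^ 'n::{finite,linorder}"
  proof -
    \<comment> \<open>Row \<open>i\<close> is bounded by \<open>exp (d\<^sub>i / 2)\<close> up to a constant, so that half of the exponent remains.\<close>
    have entry: "\<bar>symmetric_completion k d $ i $ j\<bar> \<le> 2 * c * exp (d $ i / 2)" for i j
    proof -
      have "d $ i + c \<le> 2 * c * (1 + d $ i / 2)"
      proof -
        have "d $ i * 1 \<le> d $ i * c" using d[of i] c1 by (intro mult_left_mono)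
        then show ?thesis using c1 by (simp add: algebra_simps)
      qed
      also have "\<dots> \<le> 2 * c * exp (d $ i / 2)"
        using c1 exp_ge_add_one_self by (intro mult_left_mono) auto
      finally show ?thesis
        using d[of i] kc[of i j] kc[of j i] c1 by (auto simp: symmetric_completion_def)
    qed
    have "det (symmetric_completion k d)
        \<le> fact CARD('n) * (\<Prod>i\<in>UNIV. 2 * c * exp (d $ i / 2))"
      by (rule det_le_fact_prod) (rule entry)
    also have "\<dots> = fact CARD('n) * (2 * c) ^ CARD('n) * exp ((\<Sum>i\<in>UNIV. d $ i) / 2)"
      by (simp add: prod.distrib exp_sum sum_divide_distrib power_mult_distrib)
    finally have "det_exp_functional k d \<le> fact CARD('n) * (2 * c) ^ CARD('n)
        * exp ((\<Sum>i\<in>UNIV. d $ i) / 2) * exp (- (\<Sum>i\<in>UNIV. d $ i))"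
      unfolding det_exp_functional_def by (intro mult_right_mono) auto
    also have "\<dots> = fact CARD('n) * (2 * c) ^ CARD('n) * exp (- (\<Sum>i\<in>UNIV. d $ i) / 2)"
      by (simp add: mult.assoc exp_add[symmetric])
    finally show ?thesis .
  qed
  show ?thesis
    by (rule that[OF _ bound]) (use c1 in auto)
qed

text \<open>The bound \<open>C exp (- tr K / 2)\<close> makes the superlevel sets of the functional at positive levels
  bounded on the closed set of positive semidefinite completions, so the maximum is attained. It is positive, hence not
  attained at a singular matrix.\<close>
lemma det_exp_functional_max:
  fixes k :: "'n::{finite,linorder} \<Rightarrow> 'n \<Rightarrow> real"
  obtains d where "positive_definite (symmetric_completion k d)"
    "\<And>e. positive_semidefinite (symmetric_completion k e)
      \<Longrightarrow> det_exp_functional k e \<le> det_exp_functional k d"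
proof -
  obtain d0 where d0: "positive_definite (symmetric_completion k d0)"
    using exists_positive_definite_completion by blast
  define m where "m = det_exp_functional k d0"
  have m: "0 < m"
    unfolding m_def det_exp_functional_def using positive_definite_det_pos[OF d0] by simp
  obtain C where C: "0 < C"
    "\<And>d. (\<And>i. 0 \<le> d $ i) \<Longrightarrow> det_exp_functional k d \<le> C * exp (- (\<Sum>i\<in>UNIV. d $ i) / 2)"
    using det_exp_functional_bound[of k] by blast
  define b where "b = 2 * ln (C / m)"
  define T where "T = {d. positive_semidefinite (symmetric_completion k d)}
    \<inter> {d. (\<Sum>i\<in>UNIV. d $ i) \<le> b}"
  have large: "d \<in> T" if d: "positive_semidefinite (symmetric_completion k d)"
    "m \<le> det_exp_functional k d" for d
  proof -
    have "m \<le> C * exp (- (\<Sum>i\<in>UNIV. d $ i) / 2)"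
      using d C(2)[of d] semidefinite_diagonal_nonneg[OF d(1)] by force
    then have "exp ((\<Sum>i\<in>UNIV. d $ i) / 2) \<le> C / m"
      using m C(1) by (simp add: exp_minus field_simps)
    then have "(\<Sum>i\<in>UNIV. d $ i) / 2 \<le> ln (C / m)"
      using m C(1) by (subst ln_ge_iff) simp_all
    then show ?thesis using d by (simp add: T_def b_def)
  qed
  have "closed T"
    unfolding T_def
    by (intro closed_Int closed_semidefinite_diagonals closed_Collect_le continuous_intros)
  moreover have "bounded T"
  proof -
    have "norm d \<le> b" if "d \<in> T" for d
    proof -
      have "norm d \<le> (\<Sum>i\<in>UNIV. \<bar>d $ i\<bar>)" by (rule norm_le_l1_cart)
      also have "\<dots> = (\<Sum>i\<in>UNIV. d $ i)"
        using that semidefinite_diagonal_nonneg[of k d] by (simp add: T_def)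
      also have "\<dots> \<le> b" using that by (simp add: T_def)
      finally show ?thesis .
    qed
    then show ?thesis unfolding bounded_iff by blast
  qed
  ultimately have "compact T" by (simp add: compact_eq_bounded_closed)
  moreover have d0T: "d0 \<in> T"
    using large[of d0] positive_definite_imp_semidefinite[OF d0] by (simp add: m_def)
  moreover have "continuous_on T (det_exp_functional k)"
    unfolding det_exp_functional_def
    by (intro continuous_intros continuous_on_det_symmetric_completion)
  ultimately obtain d where d: "d \<in> T" "\<And>e. e \<in> T \<Longrightarrow> det_exp_functional k e \<le> det_exp_functional k d"
    using continuous_attains_sup[of T "det_exp_functional k"] by blast
  have md: "m \<le> det_exp_functional k d" using d(2)[OF d0T] by (simp add: m_def)
  then have "det (symmetric_completion k d) \<noteq> 0"
    using m by (auto simp: det_exp_functional_def)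
  then have "positive_definite (symmetric_completion k d)"
    using d(1) by (simp add: T_def positive_definite_iff_semidefinite_det)
  moreover have "det_exp_functional k e \<le> det_exp_functional k d"
    if "positive_semidefinite (symmetric_completion k e)" for e
  proof (cases "m \<le> det_exp_functional k e")
    case True
    then show ?thesis using large that d(2) by blast
  next
    case False
    then show ?thesis using md by simp
  qed
  ultimately show ?thesis by (rule that)
qed

text \<open>A small change of either sign in one diagonal entry keeps the matrix semidefinite, which makes
  two-sided variation at a maximum possible.\<close>
lemma semidefinite_add_diagonal_entry:
  assumes pd: "positive_definite (symmetric_completion k d)"
    and t: "\<bar>t\<bar> * matrix_inv (symmetric_completion k d) $ p $ p \<le> 1"
  shows "positive_semidefinite (symmetric_completion k (d + t *\<^sub>R axis p 1))"
  unfolding symmetric_completion_semidefinite_iff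
proof
  fix x
  let ?K = "symmetric_completion k d" and ?r = "matrix_inv (symmetric_completion k d) $ p $ p"
  have q: "0 \<le> x \<bullet> (?K *v x)"
    using positive_definite_imp_semidefinite[OF pd] unfolding positive_semidefinite_def by blast
  have "\<bar>t\<bar> * (x $ p)\<^sup>2 \<le> \<bar>t\<bar> * (?r * (x \<bullet> (?K *v x)))"
    by (intro mult_left_mono component_square_le_form pd) simp
  also have "\<dots> \<le> 1 * (x \<bullet> (?K *v x))"
    unfolding mult.assoc[symmetric] by (intro mult_right_mono t q)
  finally have "\<bar>t\<bar> * (x $ p)\<^sup>2 \<le> x \<bullet> (?K *v x)" by simp
  moreover have "- t * (x $ p)\<^sup>2 \<le> \<bar>t\<bar> * (x $ p)\<^sup>2" by (intro mult_right_mono) auto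
  moreover have "(\<Sum>i\<in>UNIV. (d + t *\<^sub>R axis p 1) $ i * (x $ i)\<^sup>2)
      = (\<Sum>i\<in>UNIV. d $ i * (x $ i)\<^sup>2) + t * (x $ p)\<^sup>2"
  proof -
    have "(\<Sum>i\<in>UNIV. (d + t *\<^sub>R axis p 1) $ i * (x $ i)\<^sup>2)
        = (\<Sum>i\<in>UNIV. d $ i * (x $ i)\<^sup>2 + (if i = p then t * (x $ i)\<^sup>2 else 0))"
      by (intro sum.cong refl) (simp add: axis_def algebra_simps)
    then show ?thesis by (simp add: sum.distrib)
  qed
  ultimately show "0 \<le> x \<bullet> (symmetric_completion k (d + t *\<^sub>R axis p 1) *v x)"
    unfolding symmetric_completion_form[of x k "d + t *\<^sub>R axis p 1"]
    using symmetric_completion_form[of x k d] by linarith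
qed

lemma max_inverse_diagonal_one:
  assumes pd: "positive_definite (symmetric_completion k d)"
    and max: "\<And>e. positive_semidefinite (symmetric_completion k e)
      \<Longrightarrow> det_exp_functional k e \<le> det_exp_functional k d"
  shows "matrix_inv (symmetric_completion k d) $ p $ p = 1"
proof -
  define r where "r = matrix_inv (symmetric_completion k d) $ p $ p"
  have r: "0 < r"
    unfolding r_def by (intro positive_definite_diagonal_pos positive_definite_matrix_inv pd)
  define h where "h t = (1 + t * r) * exp (- t)" for t :: real
  have scale: "det_exp_functional k (d + t *\<^sub>R axis p 1) = h t * det_exp_functional k d" for t
  proof -
    have "(\<Sum>i\<in>UNIV. (d + t *\<^sub>R axis p 1) $ i) = (\<Sum>i\<in>UNIV. d $ i + (if i = p then t else 0))"
      by (intro sum.cong refl) (simp add: axis_def)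
    then have "(\<Sum>i\<in>UNIV. (d + t *\<^sub>R axis p 1) $ i) = (\<Sum>i\<in>UNIV. d $ i) + t"
      by (simp add: sum.distrib)
    then show ?thesis
      unfolding det_exp_functional_def symmetric_completion_add_axis h_def r_def
        det_add_diagonal_entry[OF positive_definite_invertible[OF pd]]
      by (simp add: exp_add exp_minus field_simps exp_diff)
  qed
  have "0 < det_exp_functional k d"
    unfolding det_exp_functional_def using positive_definite_det_pos[OF pd] by simp
  then have le: "h t \<le> h 0" if "\<bar>t\<bar> * r \<le> 1" for t
    using max[OF semidefinite_add_diagonal_entry[OF pd that[unfolded r_def]]]
    unfolding scale by (simp add: h_def)
  have "(h has_real_derivative r - 1) (at 0)"
    unfolding h_def by (auto intro!: derivative_eq_intros)
  moreover have "\<forall>t. \<bar>0 - t\<bar> < 1 / r \<longrightarrow> h t \<le> h 0"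
    using r by (auto intro!: le simp: field_simps)
  moreover have "0 < 1 / r" using r by simp
  ultimately have "r - 1 = 0" using DERIV_local_max by blast
  then show ?thesis by (simp add: r_def)
qed

section \<open>Existence and uniqueness\<close>

theorem corollary5p8:
  fixes k :: "'n::{finite,linorder} \<Rightarrow> 'n \<Rightarrow> real"
  shows "\<exists>!R :: real ^ 'n::{finite,linorder} ^ 'n::{finite,linorder}. correlation_matrix R \<and>
           (\<forall>i j. i < j \<longrightarrow> matrix_inv R $ i $ j = k i j)"
proof -
  obtain d where d: "positive_definite (symmetric_completion k d)"
    "\<And>e. positive_semidefinite (symmetric_completion k e)
      \<Longrightarrow> det_exp_functional k e \<le> det_exp_functional k d"
    using det_exp_functional_max[of k] by blast
  define R where "R = matrix_inv (symmetric_completion k d)"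
  have "matrix_inv R = symmetric_completion k d"
    unfolding R_def by (intro matrix_inv_matrix_inv positive_definite_invertible d)
  then have "\<forall>i j. i < j \<longrightarrow> matrix_inv R $ i $ j = k i j"
    by (auto simp: symmetric_completion_def)
  moreover have "correlation_matrix R"
    unfolding correlation_matrix_def R_def
    using positive_definite_matrix_inv[OF d(1)] max_inverse_diagonal_one[OF d] by blast
  ultimately show ?thesis
    by (intro ex1I[of _ R] conjI correlation_matrix_unique) auto
qed

end
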